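(* Let $\alpha,\beta>0$ and suppose $L_n,R_n\to\infty$ with $R_n/L_n\to\gamma\in(0,\infty)$. Let $(B_t)_{t\ge0}$ be the bipartite simple graph process with parameters $\alpha,\beta$ on parts $\mathcal L,\mathcal R$ with $|\mathcal L|=L_n$, $|\mathcal R|=R_n$. Define $$\mathcal Z(\alpha,\beta):=\left(\frac{1}{2(1+\alpha)}\wedge\frac{1}{2(1+\beta)}\right)\wedge\left(\left(\frac1{4+\alpha}\wedge\frac1\beta\right)\vee\left(\frac1{4+\beta}\wedge\frac1\alpha\right)\right).$$ Then for any $\delta\in(0,\mathcal Z(\alpha,\beta))$, with $t(\delta)=(L_n+R_n)^{1+\delta}$, the probability that $B_{t(\delta)}$ is disconnected tends to $1$ as $n\to\infty$.
   Context: The vertex set is $V=\mathcal L\cup\mathcal R$, a disjoint union, with $|\mathcal L|=L_n$, $|\mathcal R|=R_n$. The process $(B_t)$ starts from the graph $B_0$ on $V$ with no edges. Given $B_t$, one samples a pair $\{u,v\}$, $u\in\mathcal L$, $v\in\mathcal R$, not adjacent in $B_t$, with probability proportional (among all such non-adjacent pairs) to $(d_u(t)+\alpha)(d_v(t)+\beta)$, where $d_w(t)$ is the degree of $w$ in $B_t$, and adds the edge $\{u,v\}$ to obtain $B_{t+1}$ (the process is defined for $t\le L_nR_n$). Here $a\wedge b=\min(a,b)$, $a\vee b=\max(a,b)$. Non-integer times are to be read as their integer parts. *)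

theory Defs
  imports "HOL-Probability.Probability"
begin

text \<open>
  A simple graph on a vertex set \<open>V\<close> is given by its set of edges, each edge being a
  two-element set of vertices.  The bipartite graphs below have vertex set \<open>L \<union> R\<close> with \<open>L\<close> and
  \<open>R\<close> disjoint and finite, and all their edges have the form \<open>{u, v}\<close> with \<open>u \<in> L\<close>, \<open>v \<in> R\<close>.
\<close>

definition vertex_degree :: "'v set set \<Rightarrow> 'v \<Rightarrow> nat" where
  "vertex_degree E w = card {e \<in> E. w \<in> e}"

definition graph_connected :: "'v set \<Rightarrow> 'v set set \<Rightarrow> bool" where
  "graph_connected V E \<longleftrightarrow> (\<forall>x\<in>V. \<forall>y\<in>V. (x, y) \<in> {(a, b). {a, b} \<in> E}\<^sup>*)"

definition nonadjacent_pairs :: "'v set \<Rightarrow> 'v set \<Rightarrow> 'v set set \<Rightarrow> ('v \<times> 'v) set" where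
  "nonadjacent_pairs L R E = {(u, v). u \<in> L \<and> v \<in> R \<and> {u, v} \<notin> E}"

definition pair_weight :: "real \<Rightarrow> real \<Rightarrow> 'v set set \<Rightarrow> 'v \<times> 'v \<Rightarrow> real" where
  "pair_weight \<alpha> \<beta> E =
     (\<lambda>(u, v). (real (vertex_degree E u) + \<alpha>) * (real (vertex_degree E v) + \<beta>))"

definition next_pair_pmf ::
    "real \<Rightarrow> real \<Rightarrow> 'v set \<Rightarrow> 'v set \<Rightarrow> 'v set set \<Rightarrow> ('v \<times> 'v) pmf" where
  "next_pair_pmf \<alpha> \<beta> L R E =
     embed_pmf (\<lambda>p. if p \<in> nonadjacent_pairs L R E
                     then pair_weight \<alpha> \<beta> E p / (\<Sum>q\<in>nonadjacent_pairs L R E. pair_weight \<alpha> \<beta> E q)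
                     else 0)"

text \<open>
  \<^const>\<open>embed_pmf\<close> is only meaningful for functions that are nonnegative with total mass one;
  this is the case as soon as some pair is non-adjacent.
\<close>

lemma pmf_next_pair_pmf:
  assumes "\<alpha> > 0" "\<beta> > 0" "finite L" "finite R" "nonadjacent_pairs L R E \<noteq> {}"
  shows "pmf (next_pair_pmf \<alpha> \<beta> L R E) p =
           (if p \<in> nonadjacent_pairs L R E
            then pair_weight \<alpha> \<beta> E p / (\<Sum>q\<in>nonadjacent_pairs L R E. pair_weight \<alpha> \<beta> E q)
            else 0)"
proof -
  let ?N = "nonadjacent_pairs L R E"
  let ?S = "\<Sum>q\<in>?N. pair_weight \<alpha> \<beta> E q"
  let ?f = "\<lambda>p. if p \<in> ?N then pair_weight \<alpha> \<beta> E p / ?S else 0"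
  have "?N \<subseteq> L \<times> R"
    by (auto simp: nonadjacent_pairs_def)
  then have fin: "finite ?N"
    using assms finite_subset by blast
  have pos: "pair_weight \<alpha> \<beta> E q > 0" for q
    using assms by (auto simp: pair_weight_def add_nonneg_pos split: prod.splits)
  have S: "?S > 0"
    using fin assms pos by (intro sum_pos) auto
  have nn: "0 \<le> ?f q" for q
    using S pos[of q] by simp
  have "(\<integral>\<^sup>+ x. ennreal (?f x) \<partial>count_space UNIV) = (\<Sum>x\<in>?N. ennreal (?f x))"
    using fin by (intro nn_integral_count_space') auto
  also have "\<dots> = ennreal (\<Sum>x\<in>?N. ?f x)"
    using nn by (intro sum_ennreal)
  also have "(\<Sum>x\<in>?N. ?f x) = 1"
    using S by (simp add: sum_divide_distrib[symmetric])
  finally have "(\<integral>\<^sup>+ x. ennreal (?f x) \<partial>count_space UNIV) = 1"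
    by simp
  then show ?thesis
    unfolding next_pair_pmf_def using nn by (subst pmf_embed_pmf) auto
qed

text \<open>
  The process is defined for times up to \<open>card L * card R\<close>, when the graph has become complete
  bipartite; by convention it stays there afterwards.
\<close>

definition bipartite_step ::
    "real \<Rightarrow> real \<Rightarrow> 'v set \<Rightarrow> 'v set \<Rightarrow> 'v set set \<Rightarrow> 'v set set pmf" where
  "bipartite_step \<alpha> \<beta> L R E =
     (if nonadjacent_pairs L R E = {} then return_pmf E
      else map_pmf (\<lambda>(u, v). insert {u, v} E) (next_pair_pmf \<alpha> \<beta> L R E))"

text \<open>The law of the graph \<open>B\<^sub>t\<close>.\<close>

primrec bipartite_process ::
    "real \<Rightarrow> real \<Rightarrow> 'v set \<Rightarrow> 'v set \<Rightarrow> nat \<Rightarrow> 'v set set pmf" where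
  "bipartite_process \<alpha> \<beta> L R 0 = return_pmf {}"
| "bipartite_process \<alpha> \<beta> L R (Suc t) =
     bind_pmf (bipartite_process \<alpha> \<beta> L R t) (bipartite_step \<alpha> \<beta> L R)"

definition disconnection_exponent :: "real \<Rightarrow> real \<Rightarrow> real" where
  "disconnection_exponent \<alpha> \<beta> =
     min (min (1 / (2 * (1 + \<alpha>))) (1 / (2 * (1 + \<beta>))))
         (max (min (1 / (4 + \<alpha>)) (1 / \<beta>)) (min (1 / (4 + \<beta>)) (1 / \<alpha>)))"

end

theory Submission
  imports Defs
begin

text \<open>
  Let \<open>N = |L| + |R|\<close> and call a graph good if all its degrees are at most \<open>M = N\<^sup>m\<close>, where
  \<open>\<kappa> \<delta> < m < 1/2\<close> for some \<open>\<kappa> > 1\<close>; this is possible as \<open>\<delta> < 1 / (2 (1 + \<alpha>))\<close>.  In a good graph with \<open>t\<close>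
  edges the adjacent pairs carry weight at most \<open>t (M + \<alpha>) (M + \<beta>)\<close>, a small fraction of the weight
  \<open>(t + \<alpha> |L|) (t + \<beta> |R|)\<close> of all pairs.  Hence a left vertex \<open>u\<close> is selected with probability at most
  \<open>\<kappa> (d\<^sub>u + \<alpha>) / (t + \<alpha> |L|)\<close>, and likewise on the right.  While the graph is good, this makes the
  sum of the rising factorials of order \<open>k\<close> of the shifted degrees grow at most like
  \<open>N\<close> times \<open>1 + t / N\<close> to the power \<open>\<kappa> k\<close>, so by Markov's inequality with \<open>k\<close> large the graph stays good up to
  time \<open>N\<close> to the power \<open>1 + \<delta>\<close>.  If \<open>I\<close> is the number of isolated left vertices, the expectation of
  \<open>1 / (I + 1)\<close> on good graphs grows at most by the factor \<open>(1 + t / (\<alpha> |L|))\<close> to the power \<open>2 (1 + \<alpha>)\<close>,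
  which is \<open>o(N)\<close>; since it starts below \<open>1 / |L|\<close>, it tends to \<open>0\<close>, and it bounds the probability that
  no left vertex is isolated.
\<close>

section \<open>Bipartite graphs as edge sets, and degree counting\<close>

definition bipartite_edges :: "'v set \<Rightarrow> 'v set \<Rightarrow> 'v set set \<Rightarrow> bool" where
  "bipartite_edges L R E \<longleftrightarrow> E \<subseteq> (\<lambda>(u, v). {u, v}) ` (L \<times> R)"

definition degrees_le :: "real \<Rightarrow> 'v set \<Rightarrow> 'v set set \<Rightarrow> bool" where
  "degrees_le M V E \<longleftrightarrow> (\<forall>w\<in>V. real (vertex_degree E w) \<le> M)"

definition isolated :: "'v set \<Rightarrow> 'v set set \<Rightarrow> 'v set" where
  "isolated L E = {u\<in>L. vertex_degree E u = 0}"

text \<open>The normalising constant of \<open>next_pair_pmf\<close>.\<close>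

definition total_weight :: "real \<Rightarrow> real \<Rightarrow> 'v set \<Rightarrow> 'v set \<Rightarrow> 'v set set \<Rightarrow> real" where
  "total_weight \<alpha> \<beta> L R E = (\<Sum>q\<in>nonadjacent_pairs L R E. pair_weight \<alpha> \<beta> E q)"

lemma bipartite_edges_swap: "bipartite_edges R L E \<longleftrightarrow> bipartite_edges L R E"
proof -
  have "(\<lambda>(u, v). {u, v}) ` (R \<times> L) = (\<lambda>(u, v). {u, v}) ` (L \<times> R)"
    by (auto simp: image_iff insert_commute)
  then show ?thesis by (simp add: bipartite_edges_def)
qed

lemma finite_bipartite_edges:
  "finite L \<Longrightarrow> finite R \<Longrightarrow> bipartite_edges L R E \<Longrightarrow> finite E"
  unfolding bipartite_edges_def by (meson finite_SigmaI finite_imageI finite_subset)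

lemma finite_nonadjacent_pairs: "finite L \<Longrightarrow> finite R \<Longrightarrow> finite (nonadjacent_pairs L R E)"
  by (rule finite_subset[of _ "L \<times> R"]) (auto simp: nonadjacent_pairs_def)

lemma pair_weight_pos: "\<alpha> > 0 \<Longrightarrow> \<beta> > 0 \<Longrightarrow> pair_weight \<alpha> \<beta> E p > 0"
  by (auto simp: pair_weight_def add_nonneg_pos split: prod.splits)

lemma vertex_degree_mono: "finite F \<Longrightarrow> E \<subseteq> F \<Longrightarrow> vertex_degree E w \<le> vertex_degree F w"
  unfolding vertex_degree_def by (rule card_mono) auto

lemma vertex_degree_insert:
  assumes "finite E" "e \<notin> E"
  shows "vertex_degree (insert e E) w = vertex_degree E w + (if w \<in> e then 1 else 0)"
proof -
  have "{f \<in> insert e E. w \<in> f} = (if w \<in> e then insert e {f\<in>E. w \<in> f} else {f\<in>E. w \<in> f})"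
    by auto
  with assms show ?thesis by (auto simp: vertex_degree_def)
qed

lemma degrees_le_mono: "finite F \<Longrightarrow> E \<subseteq> F \<Longrightarrow> degrees_le M V F \<Longrightarrow> degrees_le M V E"
  unfolding degrees_le_def by (meson of_nat_mono order_trans vertex_degree_mono)

lemma vertex_degree_left:
  assumes "bipartite_edges L R E" "L \<inter> R = {}" "u \<in> L"
  shows "vertex_degree E u = card {v\<in>R. {u, v} \<in> E}"
proof -
  have "inj_on (\<lambda>v. {u, v}) {v\<in>R. {u, v} \<in> E}"
    by (auto simp: inj_on_def doubleton_eq_iff)
  moreover have "(\<lambda>v. {u, v}) ` {v\<in>R. {u, v} \<in> E} = {e\<in>E. u \<in> e}"
  proof (intro equalityI subsetI)
    fix e assume e: "e \<in> {e\<in>E. u \<in> e}"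
    then obtain x v where "e = {x, v}" "x \<in> L" "v \<in> R"
      using assms(1) unfolding bipartite_edges_def
      by (auto dest!: subsetD)
    with e assms(2,3) show "e \<in> (\<lambda>v. {u, v}) ` {v\<in>R. {u, v} \<in> E}"
      by auto
  qed auto
  ultimately have "bij_betw (\<lambda>v. {u, v}) {v\<in>R. {u, v} \<in> E} {e\<in>E. u \<in> e}"
    by (simp add: bij_betw_def)
  then show ?thesis
    by (simp add: vertex_degree_def bij_betw_same_card[symmetric])
qed

text \<open>Because the sides are disjoint, an unordered edge determines which end is left, so
  adjacent ordered pairs can be counted by \<open>card E\<close>.\<close>

lemma bij_betw_edges:
  assumes "bipartite_edges L R E" "L \<inter> R = {}"
  shows "bij_betw (\<lambda>(u, v). {u, v}) {(u, v). u \<in> L \<and> v \<in> R \<and> {u, v} \<in> E} E"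
proof -
  have "inj_on (\<lambda>(u, v). {u, v}) (L \<times> R)"
    using assms(2) by (auto simp: inj_on_def doubleton_eq_iff)
  then have "inj_on (\<lambda>(u, v). {u, v}) {(u, v). u \<in> L \<and> v \<in> R \<and> {u, v} \<in> E}"
    by (rule inj_on_subset) auto
  moreover have "(\<lambda>(u, v). {u, v}) ` {(u, v). u \<in> L \<and> v \<in> R \<and> {u, v} \<in> E} = E"
    using assms(1) unfolding bipartite_edges_def by (force simp: image_iff)
  ultimately show ?thesis by (simp add: bij_betw_def)
qed

lemma sum_vertex_degree_left:
  assumes "bipartite_edges L R E" "L \<inter> R = {}" "finite L" "finite R"
  shows "(\<Sum>u\<in>L. vertex_degree E u) = card E"
proof -
  have "(\<Sum>u\<in>L. vertex_degree E u) = card (SIGMA u:L. {v\<in>R. {u, v} \<in> E})"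
    using assms by (subst card_SigmaI) (auto simp: vertex_degree_left)
  also have "(SIGMA u:L. {v\<in>R. {u, v} \<in> E}) = {(u, v). u \<in> L \<and> v \<in> R \<and> {u, v} \<in> E}"
    by auto
  also have "card \<dots> = card E"
    using bij_betw_edges[OF assms(1,2)] by (rule bij_betw_same_card)
  finally show ?thesis .
qed

section \<open>Total weights of vertices and of pairs\<close>

lemma sum_weight_left:
  assumes "bipartite_edges L R E" "L \<inter> R = {}" "finite L" "finite R"
  shows "(\<Sum>u\<in>L. real (vertex_degree E u) + \<alpha>) = real (card E) + \<alpha> * card L"
  using sum_vertex_degree_left[OF assms] by (simp add: sum.distrib flip: of_nat_sum)

lemma sum_weight_right:
  assumes "bipartite_edges L R E" "L \<inter> R = {}" "finite L" "finite R"
  shows "(\<Sum>v\<in>R. real (vertex_degree E v) + \<beta>) = real (card E) + \<beta> * card R"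
  using sum_weight_left[of R L E] assms by (auto simp: bipartite_edges_swap Int_commute)

text \<open>The weight of all pairs factors into the product on the left. There are
  \<open>card E\<close> adjacent pairs, each of weight at most
  \<open>(M + \<alpha>) * (M + \<beta>)\<close>, and
  \<open>card E * (\<alpha> * card L + \<beta> * card R)\<close> is the cross term of that product;
  so they take at most the fraction \<open>1 - 1 / \<kappa>\<close> of it.\<close>

lemma total_weight_ge:
  fixes \<alpha> \<beta> \<kappa> M :: real
  assumes "\<alpha> > 0" "\<beta> > 0" and fin: "finite L" "finite R" and disj: "L \<inter> R = {}"
    and E: "bipartite_edges L R E" "degrees_le M (L \<union> R) E"
    and \<kappa>: "\<kappa> \<ge> 1" "(M + \<alpha>) * (M + \<beta>) \<le> (1 - 1 / \<kappa>) * (\<alpha> * card L + \<beta> * card R)"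
  shows "(card E + \<alpha> * card L) * (card E + \<beta> * card R) \<le> \<kappa> * total_weight \<alpha> \<beta> L R E"
proof -
  define A where "A = {(u, v). u \<in> L \<and> v \<in> R \<and> {u, v} \<in> E}"
  define W where "W = (card E + \<alpha> * card L) * (card E + \<beta> * card R)"
  have AN: "L \<times> R = A \<union> nonadjacent_pairs L R E" "A \<inter> nonadjacent_pairs L R E = {}"
    by (auto simp: A_def nonadjacent_pairs_def)
  have "A \<subseteq> L \<times> R" by (auto simp: A_def)
  then have finA: "finite A"
    using fin by (meson finite_SigmaI finite_subset)
  have "W = (\<Sum>p\<in>L \<times> R. pair_weight \<alpha> \<beta> E p)"
    unfolding W_def pair_weight_def
    using E disj fin
    by (simp flip: sum_weight_left[of L R E] sum_weight_right[of L R E] sum.cartesian_product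
          add: sum_product)
  also have "\<dots> = (\<Sum>p\<in>A. pair_weight \<alpha> \<beta> E p) + total_weight \<alpha> \<beta> L R E"
    unfolding AN(1) total_weight_def
    by (rule sum.union_disjoint) (use AN finA fin in \<open>auto intro: finite_nonadjacent_pairs\<close>)
  finally have W: "W = (\<Sum>p\<in>A. pair_weight \<alpha> \<beta> E p) + total_weight \<alpha> \<beta> L R E" .
  have "pair_weight \<alpha> \<beta> E p \<le> (M + \<alpha>) * (M + \<beta>)" if "p \<in> A" for p
    using that E(2) assms(1,2) unfolding A_def pair_weight_def degrees_le_def
    by (force intro!: mult_mono)
  then have "(\<Sum>p\<in>A. pair_weight \<alpha> \<beta> E p) \<le> real (card A) * ((M + \<alpha>) * (M + \<beta>))"
    by (rule sum_bounded_above)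
  also have "card A = card E"
    unfolding A_def using bij_betw_edges[OF E(1) disj] by (rule bij_betw_same_card)
  also have "real (card E) * ((M + \<alpha>) * (M + \<beta>))
      \<le> real (card E) * ((1 - 1 / \<kappa>) * (\<alpha> * card L + \<beta> * card R))"
    by (intro mult_left_mono \<kappa>) auto
  also have "\<dots> = (1 - 1 / \<kappa>) * (real (card E) * (\<alpha> * card L + \<beta> * card R))"
    by simp
  also have "\<dots> \<le> (1 - 1 / \<kappa>) * W"
    using \<kappa>(1) assms(1,2) by (intro mult_left_mono) (auto simp: W_def algebra_simps)
  finally have "W / \<kappa> \<le> total_weight \<alpha> \<beta> L R E"
    unfolding W by (simp add: algebra_simps add_divide_distrib)
  then show ?thesis
    unfolding W_def[symmetric] using \<kappa>(1) by (simp add: field_simps)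
qed

text \<open>With no pair left the total weight would be zero, against the positive lower bound of
  \<open>total_weight_ge\<close>.\<close>

lemma nonadjacent_pairs_nonempty:
  fixes \<alpha> \<beta> \<kappa> M :: real
  assumes "\<alpha> > 0" "\<beta> > 0" and "finite L" "finite R" "L \<inter> R = {}" "L \<noteq> {}" "R \<noteq> {}"
    and "bipartite_edges L R E" "degrees_le M (L \<union> R) E"
    and "\<kappa> \<ge> 1" "(M + \<alpha>) * (M + \<beta>) \<le> (1 - 1 / \<kappa>) * (\<alpha> * card L + \<beta> * card R)"
  shows "nonadjacent_pairs L R E \<noteq> {}"
proof
  assume "nonadjacent_pairs L R E = {}"
  then have "(card E + \<alpha> * card L) * (card E + \<beta> * card R) \<le> 0"
    using total_weight_ge[of \<alpha> \<beta> L R E M \<kappa>] assms by (simp add: total_weight_def)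
  moreover have "card L > 0" "card R > 0"
    using assms by (auto simp: card_gt_0_iff)
  then have "(card E + \<alpha> * card L) * (card E + \<beta> * card R) > 0"
    using assms(1,2) by (intro mult_pos_pos add_nonneg_pos) auto
  ultimately show False by simp
qed

section \<open>One step of the process: expectation, support, left-right symmetry\<close>

lemma expectation_bipartite_step:
  assumes "\<alpha> > 0" "\<beta> > 0" "finite L" "finite R" "nonadjacent_pairs L R E \<noteq> {}"
  shows "measure_pmf.expectation (bipartite_step \<alpha> \<beta> L R E) f =
    (\<Sum>(u, v)\<in>nonadjacent_pairs L R E.
        pair_weight \<alpha> \<beta> E (u, v) * (f (insert {u, v} E) :: real)) / total_weight \<alpha> \<beta> L R E"
proof -
  have "measure_pmf.expectation (bipartite_step \<alpha> \<beta> L R E) f =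
      measure_pmf.expectation (next_pair_pmf \<alpha> \<beta> L R E) (\<lambda>(u, v). f (insert {u, v} E))"
    using assms by (simp add: bipartite_step_def case_prod_unfold)
  also have "\<dots> = (\<Sum>p\<in>nonadjacent_pairs L R E. (case p of (u, v) \<Rightarrow> f (insert {u, v} E)) *
      pmf (next_pair_pmf \<alpha> \<beta> L R E) p)"
    by (rule integral_measure_pmf_real)
       (use assms in \<open>auto simp: set_pmf_iff pmf_next_pair_pmf finite_nonadjacent_pairs split: if_splits\<close>)
  also have "\<dots> = (\<Sum>p\<in>nonadjacent_pairs L R E.
      (case p of (u, v) \<Rightarrow> pair_weight \<alpha> \<beta> E (u, v) * f (insert {u, v} E)) / total_weight \<alpha> \<beta> L R E)"
    using assms by (intro sum.cong) (auto simp: pmf_next_pair_pmf total_weight_def)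
  finally show ?thesis
    by (simp add: sum_divide_distrib)
qed

lemma set_pmf_bipartite_step:
  assumes "\<alpha> > 0" "\<beta> > 0" "finite L" "finite R"
  shows "set_pmf (bipartite_step \<alpha> \<beta> L R E) =
    (if nonadjacent_pairs L R E = {} then {E}
     else (\<lambda>(u, v). insert {u, v} E) ` nonadjacent_pairs L R E)"
proof (cases "nonadjacent_pairs L R E = {}")
  case False
  have "(\<Sum>q\<in>nonadjacent_pairs L R E. pair_weight \<alpha> \<beta> E q) > 0"
    using assms False by (intro sum_pos finite_nonadjacent_pairs pair_weight_pos)
  then have "set_pmf (next_pair_pmf \<alpha> \<beta> L R E) = nonadjacent_pairs L R E"
    using pair_weight_pos[OF assms(1,2), of E, THEN less_imp_neq, symmetric]
    by (auto simp: set_pmf_iff pmf_next_pair_pmf[OF assms False] split: if_splits)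
  with False show ?thesis by (simp add: bipartite_step_def)
qed (simp add: bipartite_step_def)

text \<open>Edges are unordered, and the weight is invariant under exchanging the sides together
  with their parameters. This carries estimates for left vertices over to right vertices.\<close>

lemma bipartite_step_swap:
  assumes "\<alpha> > 0" "\<beta> > 0" "finite L" "finite R"
  shows "bipartite_step \<beta> \<alpha> R L E = bipartite_step \<alpha> \<beta> L R E"
proof -
  have N: "nonadjacent_pairs R L E = prod.swap ` nonadjacent_pairs L R E"
    by (auto simp: nonadjacent_pairs_def insert_commute image_iff)
  have w: "pair_weight \<beta> \<alpha> E (prod.swap p) = pair_weight \<alpha> \<beta> E p" for p
    by (cases p) (simp add: pair_weight_def)
  have S: "(\<Sum>q\<in>nonadjacent_pairs R L E. pair_weight \<beta> \<alpha> E q) =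
      (\<Sum>q\<in>nonadjacent_pairs L R E. pair_weight \<alpha> \<beta> E q)"
    unfolding N by (subst sum.reindex) (auto simp: w)
  show ?thesis
  proof (cases "nonadjacent_pairs L R E = {}")
    case False
    then have "nonadjacent_pairs R L E \<noteq> {}" by (simp add: N)
    then have "pmf (next_pair_pmf \<beta> \<alpha> R L E) (prod.swap p) = pmf (next_pair_pmf \<alpha> \<beta> L R E) p" for p
      using assms False
      by (simp add: pmf_next_pair_pmf S w) (simp add: N inj_image_mem_iff)
    then have "pmf (next_pair_pmf \<beta> \<alpha> R L E) p =
        pmf (map_pmf prod.swap (next_pair_pmf \<alpha> \<beta> L R E)) p" for p
      using pmf_map_inj'[of prod.swap "next_pair_pmf \<alpha> \<beta> L R E" "prod.swap p"]
      by (metis inj_swap swap_swap)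
    then have "next_pair_pmf \<beta> \<alpha> R L E = map_pmf prod.swap (next_pair_pmf \<alpha> \<beta> L R E)"
      by (rule pmf_eqI)
    with False N show ?thesis
      by (simp add: bipartite_step_def map_pmf_comp case_prod_unfold insert_commute)
  qed (simp add: N bipartite_step_def)
qed

section \<open>Rising factorials and elementary inequalities\<close>

lemma pochhammer_plus_one:
  fixes a :: real
  assumes "a > 0"
  shows "pochhammer (a + 1) k = pochhammer a k + pochhammer a k * k / a"
proof -
  \<comment> \<open>Both sides equal \<open>pochhammer a (Suc k)\<close>, with the first or the last
    factor split off.\<close>
  have "a * pochhammer (a + 1) k = (a + k) * pochhammer a k"
    by (metis pochhammer_rec pochhammer_rec')
  with assms show ?thesis by (simp add: field_simps)
qed

lemma power_le_pochhammer: "0 \<le> (x :: real) \<Longrightarrow> x ^ k \<le> pochhammer x k"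
proof (induction k)
  case (Suc k)
  then have "x * x ^ k \<le> (x + k) * pochhammer x k"
    by (intro mult_mono) auto
  then show ?case by (simp add: pochhammer_rec')
qed simp

text \<open>Bernoulli's inequality for real exponents: equality holds at 0, and the difference of
  the sides has nonnegative derivative. It makes the one-step growth factors telescope.\<close>

lemma one_plus_mult_le_powr:
  fixes c x :: real
  assumes "c \<ge> 1" "x \<ge> 0"
  shows "1 + c * x \<le> (1 + x) powr c"
proof -
  let ?f = "\<lambda>x. (1 + x) powr c - c * x" and ?f' = "\<lambda>x. c * (1 + x) powr (c - 1) - c"
  have "?f 0 \<le> ?f x"
  proof (rule DERIV_nonneg_imp_nondecreasing[OF \<open>x \<ge> 0\<close>])
    fix y :: real assume "0 \<le> y" "y \<le> x"
    then have "(?f has_real_derivative ?f' y) (at y)"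
      by (auto intro!: derivative_eq_intros)
    moreover have "1 \<le> (1 + y) powr (c - 1)"
      using \<open>0 \<le> y\<close> assms(1) by (intro ge_one_powr_ge_zero) auto
    then have "?f' y \<ge> 0" using assms(1) by simp
    ultimately show "\<exists>z. (?f has_real_derivative z) (at y) \<and> z \<ge> 0" by blast
  qed
  then show ?thesis by simp
qed

lemma expectation_mono_finite:
  fixes f g :: "'a \<Rightarrow> real"
  assumes "finite (set_pmf p)" "\<And>x. x \<in> set_pmf p \<Longrightarrow> f x \<le> g x"
  shows "measure_pmf.expectation p f \<le> measure_pmf.expectation p g"
  using assms by (intro integral_mono_AE integrable_measure_pmf_finite) (auto simp: AE_measure_pmf_iff)

section \<open>Drift of observables in one step from a good graph\<close>

locale bounded_degree_regime =
  fixes \<alpha> \<beta> \<kappa> M :: real and L R :: "'v set"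
  assumes pos: "\<alpha> > 0" "\<beta> > 0" and fin: "finite L" "finite R"
    and disj: "L \<inter> R = {}" and nonempty: "L \<noteq> {}" "R \<noteq> {}" and M: "M \<ge> 0" and \<kappa>: "\<kappa> \<ge> 1"
    and small: "(M + \<alpha>) * (M + \<beta>) \<le> (1 - 1 / \<kappa>) * (\<alpha> * card L + \<beta> * card R)"
begin

lemma swap: "bounded_degree_regime \<beta> \<alpha> \<kappa> M R L"
  using pos fin disj nonempty M \<kappa> small
  by unfold_locales (auto simp: Int_commute mult.commute add.commute)

abbreviation "good \<equiv> degrees_le M (L \<union> R)"
abbreviation "step \<equiv> bipartite_step \<alpha> \<beta> L R"
abbreviation "process \<equiv> bipartite_process \<alpha> \<beta> L R"
abbreviation "missing \<equiv> nonadjacent_pairs L R"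

lemma missing_nonempty: "bipartite_edges L R E \<Longrightarrow> good E \<Longrightarrow> missing E \<noteq> {}"
  using nonadjacent_pairs_nonempty[OF pos fin disj nonempty _ _ \<kappa> small] .

lemma total_weight_pos: "missing E \<noteq> {} \<Longrightarrow> total_weight \<alpha> \<beta> L R E > 0"
  unfolding total_weight_def
  by (intro sum_pos finite_nonadjacent_pairs fin pair_weight_pos pos)

lemma card_pos: "card L > 0" "card R > 0"
  using fin nonempty by (auto simp: card_gt_0_iff)

text \<open>Serves both observables below, whose increment depends only on the left end
  \<open>u\<close> of the new edge. The weight factors over all pairs, and its right factor cancels
  against the lower bound for the total weight; what remains is a bound for the probability of
  selecting \<open>u\<close>.\<close>

lemma expectation_step_left_le:
  assumes E: "bipartite_edges L R E" "good E"
    and f: "\<And>u v. (u, v) \<in> missing E \<Longrightarrow> f (insert {u, v} E) = f E + g u"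
    and g: "\<And>u. g u \<ge> 0"
  shows "measure_pmf.expectation (step E) f
      \<le> f E + \<kappa> / (card E + \<alpha> * card L) * (\<Sum>u\<in>L. (vertex_degree E u + \<alpha>) * g u)"
proof -
  define S where "S = total_weight \<alpha> \<beta> L R E"
  define a where "a = card E + \<alpha> * card L"
  define b where "b = card E + \<beta> * card R"
  define G where "G = (\<Sum>u\<in>L. (vertex_degree E u + \<alpha>) * g u)"
  have NA: "missing E \<noteq> {}" using E by (rule missing_nonempty)
  have S: "S > 0" unfolding S_def using NA by (rule total_weight_pos)
  have ab: "a > 0" "b > 0"
    using pos card_pos by (simp_all add: a_def b_def add_nonneg_pos)
  have Sab: "a * b \<le> \<kappa> * S"
    unfolding a_def b_def S_def using total_weight_ge[OF pos fin disj E \<kappa> small] .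
  have nonneg: "pair_weight \<alpha> \<beta> E p * g u \<ge> 0" for p u
    by (rule mult_nonneg_nonneg[OF pair_weight_pos[OF pos, THEN less_imp_le] g])
  \<comment> \<open>As \<open>g\<close> is nonnegative, adjacent pairs may be included; over the
    full rectangle the double sum factors.\<close>
  have "(\<Sum>(u, v)\<in>missing E. pair_weight \<alpha> \<beta> E (u, v) * g u)
      \<le> (\<Sum>(u, v)\<in>L \<times> R. pair_weight \<alpha> \<beta> E (u, v) * g u)"
    using fin nonneg by (intro sum_mono2) (auto simp: nonadjacent_pairs_def)
  also have "\<dots> = (\<Sum>(u, v)\<in>L \<times> R. ((vertex_degree E u + \<alpha>) * g u) * (vertex_degree E v + \<beta>))"
    by (intro sum.cong) (auto simp: pair_weight_def)
  also have "\<dots> = G * b"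
    unfolding G_def b_def sum_weight_right[OF E(1) disj fin, symmetric]
    by (simp add: sum_product sum.cartesian_product)
  finally have *: "(\<Sum>(u, v)\<in>missing E. pair_weight \<alpha> \<beta> E (u, v) * g u) \<le> G * b" .
  have G: "G \<ge> 0" unfolding G_def using g pos by (intro sum_nonneg mult_nonneg_nonneg) auto
  have "measure_pmf.expectation (step E) f =
      (\<Sum>(u, v)\<in>missing E. pair_weight \<alpha> \<beta> E (u, v) * f E + pair_weight \<alpha> \<beta> E (u, v) * g u) / S"
    unfolding expectation_bipartite_step[OF pos fin NA] S_def
    by (intro arg_cong2[where f = "(/)"] sum.cong) (auto simp: f algebra_simps)
  also have "\<dots> = (S * f E + (\<Sum>(u, v)\<in>missing E. pair_weight \<alpha> \<beta> E (u, v) * g u)) / S"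
    by (simp add: case_prod_unfold sum.distrib S_def total_weight_def sum_distrib_right)
  also have "\<dots> \<le> (S * f E + G * b) / S"
    using * S by (intro divide_right_mono) auto
  also have "\<dots> = f E + G * b / S"
    using S by (simp add: field_simps)
  \<comment> \<open>The right weight \<open>b\<close> cancels through
    \<open>a * b \<le> \<kappa> * S\<close>.\<close>
  also have "b / S \<le> \<kappa> / a"
    using ab S Sab by (simp add: field_simps)
  then have "G * b / S \<le> \<kappa> / a * G"
    using mult_left_mono[OF _ G] by (metis mult.commute times_divide_eq_right)
  finally show ?thesis unfolding a_def G_def by simp
qed

text \<open>
  Rising factorials of \<open>d + \<alpha>\<close> are used instead of powers because raising \<open>d\<close> by one multiplies them by
  \<open>1 + k / (d + \<alpha>)\<close>, which cancels the weight \<open>d + \<alpha>\<close> in the attachment probability.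
\<close>

definition degree_moment :: "nat \<Rightarrow> 'v set set \<Rightarrow> real" where
  "degree_moment k E = (\<Sum>u\<in>L. pochhammer (vertex_degree E u + \<alpha>) k)"

lemma degree_moment_nonneg: "degree_moment k E \<ge> 0"
  unfolding degree_moment_def using pos by (intro sum_nonneg pochhammer_nonneg) (simp add: add_nonneg_pos)

lemma vertex_degree_insert_missing:
  assumes "bipartite_edges L R E" "(u, v) \<in> missing E"
  shows "vertex_degree (insert {u, v} E) w = vertex_degree E w + (if w = u \<or> w = v then 1 else 0)"
  using assms finite_bipartite_edges[OF fin assms(1)]
  by (subst vertex_degree_insert) (auto simp: nonadjacent_pairs_def)

lemma expectation_degree_moment_le:
  assumes E: "bipartite_edges L R E" "good E"
  shows "measure_pmf.expectation (step E) (degree_moment k)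
      \<le> (1 + \<kappa> * k / (card E + \<alpha> * card L)) * degree_moment k E"
proof -
  define d where "d u = vertex_degree E u + \<alpha>" for u
  define g where "g u = pochhammer (d u) k * k / d u" for u
  have d: "d u > 0" for u using pos by (simp add: d_def add_nonneg_pos)
  have "degree_moment k (insert {u, v} E) = degree_moment k E + g u" if "(u, v) \<in> missing E" for u v
  proof -
    \<comment> \<open>The end \<open>v\<close> lies outside \<open>L\<close>, so only the summand of
      \<open>u\<close> changes.\<close>
    have uv: "u \<in> L" "v \<notin> L" using that disj by (auto simp: nonadjacent_pairs_def)
    have "degree_moment k (insert {u, v} E) = (\<Sum>x\<in>L. pochhammer (d x) k + (if x = u then g u else 0))"
      unfolding degree_moment_def
      using uv pochhammer_plus_one[OF d, of u k]
      by (intro sum.cong)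
         (auto simp: vertex_degree_insert_missing[OF E(1) that] g_def d_def add_ac)
    also have "\<dots> = degree_moment k E + g u"
      using uv fin by (simp add: sum.distrib degree_moment_def d_def)
    finally show ?thesis .
  qed
  moreover have "g u \<ge> 0" for u
    unfolding g_def using d by (intro divide_nonneg_nonneg mult_nonneg_nonneg pochhammer_nonneg) (auto intro: less_imp_le)
  ultimately have "measure_pmf.expectation (step E) (degree_moment k)
      \<le> degree_moment k E + \<kappa> / (card E + \<alpha> * card L) * (\<Sum>u\<in>L. d u * g u)"
    unfolding d_def by (intro expectation_step_left_le E) 
  also have "(\<Sum>u\<in>L. d u * g u) = k * degree_moment k E"
    using d[THEN less_imp_neq] unfolding degree_moment_def sum_distrib_left
    by (intro sum.cong) (auto simp: g_def simp flip: d_def)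
  finally show ?thesis by (simp add: algebra_simps)
qed

text \<open>
  Losing one of \<open>I\<close> isolated vertices raises \<open>1 / (I + 1)\<close> by \<open>1 / (I (I + 1))\<close>, and the probability of
  such a loss is proportional to \<open>I\<close>.
\<close>

lemma expectation_isolated_le:
  assumes E: "bipartite_edges L R E" "good E"
  shows "measure_pmf.expectation (step E) (\<lambda>E. 1 / (card (isolated L E) + 1))
      \<le> (1 + \<kappa> * \<alpha> / (card E + \<alpha> * card L)) * (1 / (card (isolated L E) + 1))"
proof -
  define I where "I = isolated L E"
  have I: "finite I" "I \<subseteq> L" using fin by (auto simp: I_def isolated_def)
  define g :: "'v \<Rightarrow> real" where "g u = (if u \<in> I then 1 / card I - 1 / (card I + 1) else 0)" for u
  have "1 / (card (isolated L (insert {u, v} E)) + 1) = 1 / (card I + 1) + g u"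
    if "(u, v) \<in> missing E" for u v
  proof -
    have uv: "u \<in> L" "v \<notin> L" using that disj by (auto simp: nonadjacent_pairs_def)
    have *: "isolated L (insert {u, v} E) = I - {u}"
      using uv by (auto simp: isolated_def I_def vertex_degree_insert_missing[OF E(1) that])
    have **: "card (I - {u}) + 1 = (if u \<in> I then card I else card I + 1)"
      using I by (simp add: card_Diff_singleton_if)
        (metis Suc_pred card_gt_0_iff empty_iff)
    have "1 / (card (isolated L (insert {u, v} E)) + 1) = 1 / real (if u \<in> I then card I else card I + 1)"
      by (simp only: * **)
    then show ?thesis by (simp only: g_def) simp
  qed
  moreover have "g u \<ge> 0" for u
    using I by (auto simp: g_def card_gt_0_iff intro!: divide_left_mono mult_pos_pos)
  ultimately have *: "measure_pmf.expectation (step E) (\<lambda>E. 1 / (card (isolated L E) + 1))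
      \<le> 1 / (card I + 1) + \<kappa> / (card E + \<alpha> * card L) * (\<Sum>u\<in>L. (vertex_degree E u + \<alpha>) * g u)"
    unfolding I_def by (intro expectation_step_left_le E)
  have "(\<Sum>u\<in>L. (vertex_degree E u + \<alpha>) * g u) = (\<Sum>u\<in>I. \<alpha> * (1 / card I - 1 / (card I + 1)))"
    using I fin by (intro sum.mono_neutral_cong_right) (auto simp: g_def I_def isolated_def)
  also have "\<dots> \<le> \<alpha> * (1 / (card I + 1))"
  \<comment> \<open>For empty \<open>I\<close> the sum is 0 and only the inequality holds; the
    identity used otherwise divides by \<open>card I\<close>.\<close>
  proof (cases "card I = 0")
    case False
    then have "card I * (1 / card I - 1 / (card I + 1)) = 1 / (card I + 1)"
      by (simp add: divide_simps)
    then show ?thesis by (simp add: mult.left_commute)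
  qed (use pos in simp)
  finally have "\<kappa> / (card E + \<alpha> * card L) * (\<Sum>u\<in>L. (vertex_degree E u + \<alpha>) * g u)
      \<le> \<kappa> / (card E + \<alpha> * card L) * (\<alpha> * (1 / (card I + 1)))"
    using pos \<kappa> by (intro mult_left_mono) auto
  also have "1 / (card I + 1) + \<dots> = (1 + \<kappa> * \<alpha> / (card E + \<alpha> * card L)) * (1 / (card I + 1))"
    by (simp only: distrib_right mult_1 add_divide_distrib times_divide_eq_left times_divide_eq_right mult.assoc)
  finally show ?thesis
    using * unfolding I_def[symmetric] by linarith
qed

section \<open>Invariants of the process and growth over time\<close>

lemma bipartite_edges_step:
  assumes "bipartite_edges L R E" "F \<in> set_pmf (step E)"
  shows "bipartite_edges L R F"
  using assms by (auto simp: set_pmf_bipartite_step[OF pos fin] bipartite_edges_def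
      nonadjacent_pairs_def split: if_splits)

lemma step_mono: "F \<in> set_pmf (step E) \<Longrightarrow> E \<subseteq> F"
  by (auto simp: set_pmf_bipartite_step[OF pos fin] split: if_splits)

lemma finite_set_step: "finite (set_pmf (step E))"
  by (simp add: set_pmf_bipartite_step[OF pos fin] finite_nonadjacent_pairs fin)

lemma bipartite_edges_process: "E \<in> set_pmf (process t) \<Longrightarrow> bipartite_edges L R E"
  by (induction t arbitrary: E) (auto simp: bipartite_edges_def[of L R "{}"] intro: bipartite_edges_step)

lemma finite_set_process: "finite (set_pmf (process t))"
  by (induction t) (auto simp: finite_set_step)

text \<open>Edges are only added, so degrees never decrease and a bad graph stays bad. The indicator
  of goodness thereby acts like a stopping time.\<close>

lemma good_step: "bipartite_edges L R E \<Longrightarrow> F \<in> set_pmf (step E) \<Longrightarrow> good F \<Longrightarrow> good E"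
  by (meson bipartite_edges_step degrees_le_mono finite_bipartite_edges[OF fin] step_mono)

text \<open>All predecessors of a good graph are good and hence miss a pair, so every step really
  added an edge; a complete graph would have stayed unchanged.\<close>

lemma card_process: "E \<in> set_pmf (process t) \<Longrightarrow> good E \<Longrightarrow> card E = t"
proof (induction t arbitrary: E)
  case (Suc t F)
  then obtain E where E: "E \<in> set_pmf (process t)" "F \<in> set_pmf (step E)" by auto
  then have b: "bipartite_edges L R E" and "good E"
    using Suc.prems bipartite_edges_process good_step by blast+
  then have NA: "missing E \<noteq> {}" and c: "card E = t"
    using missing_nonempty Suc.IH E by blast+
  obtain u v where "(u, v) \<in> missing E" "F = insert {u, v} E"
    using E(2) NA by (auto simp: set_pmf_bipartite_step[OF pos fin])
  then show ?case
    using c finite_bipartite_edges[OF fin b] by (simp add: nonadjacent_pairs_def)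
qed auto

lemma expectation_process_Suc:
  "measure_pmf.expectation (process (Suc t)) f =
    measure_pmf.expectation (process t) (\<lambda>E. measure_pmf.expectation (step E) f)" for f :: "_ \<Rightarrow> real"
  by (simp add: pmf_expectation_bind[OF finite_set_process finite_set_step order_refl]
      integral_measure_pmf[OF finite_set_process])

text \<open>Degree moments and the inverse count of isolated vertices obey the same kind of drift,
  so the bounds over time are derived once for a general observable \<open>f\<close>.\<close>

context
  fixes f :: "'v set set \<Rightarrow> real" and a c :: real
  assumes f_nonneg: "\<And>E. f E \<ge> 0" and a: "a > 0" and c: "c \<ge> 1"
    and drift: "\<And>E. bipartite_edges L R E \<Longrightarrow> good E \<Longrightarrow>
      measure_pmf.expectation (step E) f \<le> (1 + c / (card E + a)) * f E"
begin

text \<open>By Bernoulli the one-step factor is at most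
  \<open>((Suc t + a) / (t + a)) powr c\<close>, and these ratios telescope.\<close>

lemma growth_factor: "(1 + c / (t + a)) * ((t + a) / a) powr c \<le> ((Suc t + a) / a) powr c"
proof -
  have "1 + c / (t + a) \<le> (1 + 1 / (t + a)) powr c"
    using one_plus_mult_le_powr[of c "1 / (t + a)"] a c by simp
  then have "(1 + c / (t + a)) * ((t + a) / a) powr c \<le> (1 + 1 / (t + a)) powr c * ((t + a) / a) powr c"
    by (intro mult_right_mono) auto
  also have "\<dots> = ((1 + 1 / (t + a)) * ((t + a) / a)) powr c"
    using a by (subst powr_mult) auto
  also have "(1 + 1 / (t + a)) * ((t + a) / a) = (Suc t + a) / a"
    using a add_nonneg_pos[of "real t" a] by (simp add: add_divide_distrib[symmetric] add_divide_eq_iff)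
  finally show ?thesis .
qed

lemma expectation_good_le:
  "measure_pmf.expectation (process t) (\<lambda>E. of_bool (good E) * f E) \<le> ((t + a) / a) powr c * f {}"
proof (induction t)
  case 0
  then show ?case using a f_nonneg by auto
next
  case (Suc t)
  have "measure_pmf.expectation (process (Suc t)) (\<lambda>E. of_bool (good E) * f E)
      \<le> measure_pmf.expectation (process t) (\<lambda>E. (1 + c / (t + a)) * (of_bool (good E) * f E))"
    unfolding expectation_process_Suc
  proof (rule expectation_mono_finite[OF finite_set_process])
    fix E assume E: "E \<in> set_pmf (process t)"
    have b: "bipartite_edges L R E" using E by (rule bipartite_edges_process)
    \<comment> \<open>A good \<open>F\<close> only arises from a good \<open>E\<close>, so goodness
      can be tested before the step: then either the drift bound applies or both sides
      vanish.\<close>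
    have "measure_pmf.expectation (step E) (\<lambda>F. of_bool (good F) * f F)
        \<le> measure_pmf.expectation (step E) (\<lambda>F. of_bool (good E) * f F)"
      using good_step[OF b] f_nonneg by (intro expectation_mono_finite finite_set_step) auto
    also have "\<dots> \<le> (1 + c / (t + a)) * (of_bool (good E) * f E)"
      using drift[OF b] card_process[OF E] by (cases "good E") auto
    finally show "measure_pmf.expectation (step E) (\<lambda>F. of_bool (good F) * f F)
        \<le> (1 + c / (t + a)) * (of_bool (good E) * f E)" .
  qed
  also have "\<dots> \<le> (1 + c / (t + a)) * (((t + a) / a) powr c * f {})"
    using Suc a c by (simp add: mult_left_mono)
  also have "\<dots> \<le> ((Suc t + a) / a) powr c * f {}"
    using mult_right_mono[OF growth_factor f_nonneg] by (simp add: mult.assoc)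
  finally show ?case .
qed

text \<open>As \<open>f\<close> is controlled only on good graphs, Markov's inequality is applied to
  the step at which the graph turns bad: its predecessor is good, so the drift still bounds the
  expectation of \<open>f\<close> after that step. Summing over the steps costs the factor
  \<open>t\<close>.\<close>

lemma prob_not_good_le:
  assumes K: "K > 0" "\<And>E. bipartite_edges L R E \<Longrightarrow> \<not> good E \<Longrightarrow> K \<le> f E"
  shows "measure_pmf.prob (process t) {E. \<not> good E} \<le> t * (((t + a) / a) powr c * f {} / K)"
proof (induction t)
  case 0
  then show ?case using M by (simp add: degrees_le_def vertex_degree_def indicator_def)
next
  case (Suc t)
  define B where "B = ((Suc t + a) / a) powr c * f {} / K"
  have prob: "measure_pmf.prob p {E. \<not> good E} = measure_pmf.expectation p (\<lambda>E. of_bool (\<not> good E))" for p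
  proof -
    have "measure_pmf.expectation p (\<lambda>E. of_bool (\<not> good E)) =
        measure_pmf.expectation p (indicator {E. \<not> good E} :: _ \<Rightarrow> real)"
      by (intro Bochner_Integration.integral_cong) (auto simp: indicator_def)
    then show ?thesis by simp
  qed
  have "measure_pmf.prob (process (Suc t)) {E. \<not> good E}
      \<le> measure_pmf.expectation (process t)
          (\<lambda>E. of_bool (\<not> good E) + (1 + c / (t + a)) / K * (of_bool (good E) * f E))"
    unfolding prob expectation_process_Suc
  proof (rule expectation_mono_finite[OF finite_set_process])
    fix E assume E: "E \<in> set_pmf (process t)"
    have b: "bipartite_edges L R E" using E by (rule bipartite_edges_process)
    show "measure_pmf.expectation (step E) (\<lambda>E. of_bool (\<not> good E))
        \<le> of_bool (\<not> good E) + (1 + c / (t + a)) / K * (of_bool (good E) * f E)"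
    proof (cases "good E")
      case True
      have "of_bool (\<not> good F) \<le> f F / K" if "F \<in> set_pmf (step E)" for F
        using K f_nonneg[of F] bipartite_edges_step[OF b that] by (simp add: field_simps)
      then have "measure_pmf.expectation (step E) (\<lambda>E. of_bool (\<not> good E))
          \<le> measure_pmf.expectation (step E) (\<lambda>F. f F / K)"
        by (rule expectation_mono_finite[OF finite_set_step])
      also have "\<dots> \<le> (1 + c / (t + a)) * f E / K"
        using drift[OF b True] card_process[OF E True] K by (simp add: divide_right_mono)
      finally show ?thesis using True by simp
    next
      case False
      have "measure_pmf.expectation (step E) (\<lambda>E. of_bool (\<not> good E))
          \<le> measure_pmf.expectation (step E) (\<lambda>_. 1 :: real)"
        by (rule expectation_mono_finite[OF finite_set_step]) auto
      with False show ?thesis by simp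
    qed
  qed
  also have "\<dots> = measure_pmf.prob (process t) {E. \<not> good E}
      + (1 + c / (t + a)) / K * measure_pmf.expectation (process t) (\<lambda>E. of_bool (good E) * f E)"
    unfolding prob
    by (subst Bochner_Integration.integral_add)
       (auto intro: integrable_measure_pmf_finite finite_set_process)
  also have "(1 + c / (t + a)) / K * measure_pmf.expectation (process t) (\<lambda>E. of_bool (good E) * f E)
      \<le> (1 + c / (t + a)) / K * (((t + a) / a) powr c * f {})"
    using a c K by (intro mult_left_mono expectation_good_le) auto
  also have "\<dots> = (1 + c / (t + a)) * ((t + a) / a) powr c * f {} / K"
    by simp
  also have "\<dots> \<le> B"
    unfolding B_def using K f_nonneg growth_factor
    by (intro divide_right_mono mult_right_mono) auto
  \<comment> \<open>The bound increases with time, so each of the \<open>t\<close> earlier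
    contributions is replaced by the latest one, \<open>B\<close>.\<close>
  also have "measure_pmf.prob (process t) {E. \<not> good E} \<le> t * B"
  proof -
    have "((t + a) / a) powr c * f {} / K \<le> B"
      unfolding B_def using a c K f_nonneg
      by (intro divide_right_mono mult_right_mono powr_mono2) (auto simp: divide_right_mono)
    then have "t * (((t + a) / a) powr c * f {} / K) \<le> t * B"
      by (intro mult_left_mono) auto
    with Suc show ?thesis by simp
  qed
  finally show ?case by (simp add: B_def algebra_simps add_divide_distrib)
qed

end

end

section \<open>Bounds at a fixed time for large degrees, isolated vertices and connectedness\<close>

context bounded_degree_regime
begin

text \<open>Left and right moments are added so that one observable detects a large degree on either
  side; the smaller offset \<open>a\<close> gives a drift valid for both.\<close>

lemma prob_not_good_le_moment:
  fixes k :: nat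
  defines "a \<equiv> min (\<alpha> * card L) (\<beta> * card R)"
  assumes k: "k \<ge> 1" and "M > 0"
  shows "measure_pmf.prob (process t) {E. \<not> good E} \<le>
    t * (((t + a) / a) powr (\<kappa> * k) * (card L * pochhammer \<alpha> k + card R * pochhammer \<beta> k) / M ^ k)"
proof -
  interpret sw: bounded_degree_regime \<beta> \<alpha> \<kappa> M R L by (rule swap)
  define f where "f E = degree_moment k E + sw.degree_moment k E" for E
  have a: "a > 0" unfolding a_def using pos card_pos by simp
  have c: "\<kappa> * k \<ge> 1"
    using mult_mono[OF \<kappa>, of 1 "real k"] k \<kappa> by simp
  have nonneg: "f E \<ge> 0" for E
    by (simp add: f_def degree_moment_nonneg sw.degree_moment_nonneg)
  have drift: "measure_pmf.expectation (step E) f \<le> (1 + \<kappa> * k / (card E + a)) * f E"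
    if E: "bipartite_edges L R E" "good E" for E
  proof -
    have "measure_pmf.expectation (step E) f = measure_pmf.expectation (step E) (degree_moment k)
        + measure_pmf.expectation (sw.step E) (sw.degree_moment k)"
      unfolding f_def bipartite_step_swap[OF pos fin]
      by (subst Bochner_Integration.integral_add)
         (auto intro: integrable_measure_pmf_finite finite_set_step)
    also have "\<dots> \<le> (1 + \<kappa> * k / (card E + \<alpha> * card L)) * degree_moment k E
        + (1 + \<kappa> * k / (card E + \<beta> * card R)) * sw.degree_moment k E"
      using E by (intro add_mono expectation_degree_moment_le sw.expectation_degree_moment_le)
        (auto simp: bipartite_edges_swap Un_commute)
    also have "\<dots> \<le> (1 + \<kappa> * k / (card E + a)) * degree_moment k E
        + (1 + \<kappa> * k / (card E + a)) * sw.degree_moment k E"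
      using a c by (intro add_mono mult_right_mono degree_moment_nonneg sw.degree_moment_nonneg
          add_left_mono divide_left_mono mult_pos_pos) (auto simp: a_def)
    finally show ?thesis by (simp add: f_def algebra_simps)
  qed
  have large: "M ^ k \<le> f E" if "\<not> good E" for E
  proof -
    have "\<exists>w\<in>L \<union> R. real (vertex_degree E w) > M"
      using that unfolding degrees_le_def by (simp add: not_le)
    then obtain w where w: "w \<in> L \<union> R" "real (vertex_degree E w) > M"
      by blast
    \<comment> \<open>A single vertex of degree above \<open>M\<close> already contributes
      \<open>M ^ k\<close>, since the shift \<open>x\<close> only raises the base.\<close>
    have *: "M ^ k \<le> pochhammer (vertex_degree E w + x) k" if "x > 0" for x :: real
    proof -
      have "M ^ k \<le> (vertex_degree E w + x) ^ k"
        using w(2) M that by (intro power_mono) auto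
      also have "\<dots> \<le> pochhammer (vertex_degree E w + x) k"
        using that by (intro power_le_pochhammer) auto
      finally show ?thesis .
    qed
    have p: "pochhammer (vertex_degree E u + x) k \<ge> 0" if "x > 0" for u and x :: real
      using that by (intro pochhammer_nonneg) (simp add: add_nonneg_pos)
    from w(1) show ?thesis
    proof
      assume "w \<in> L"
      then have "pochhammer (vertex_degree E w + \<alpha>) k \<le> degree_moment k E"
        unfolding degree_moment_def using fin p[OF pos(1)] by (intro member_le_sum) auto
      then show ?thesis
        using *[OF pos(1)] sw.degree_moment_nonneg[of k E] by (simp add: f_def)
    next
      assume "w \<in> R"
      then have "pochhammer (vertex_degree E w + \<beta>) k \<le> sw.degree_moment k E"
        unfolding sw.degree_moment_def using fin p[OF pos(2)] by (intro member_le_sum) auto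
      then show ?thesis
        using *[OF pos(2)] degree_moment_nonneg[of k E] by (simp add: f_def)
    qed
  qed
  have "f {} = card L * pochhammer \<alpha> k + card R * pochhammer \<beta> k"
    by (simp add: f_def degree_moment_def sw.degree_moment_def vertex_degree_def)
  then show ?thesis
    using prob_not_good_le[OF nonneg a c drift, of "M ^ k" t] \<open>M > 0\<close> large by simp
qed

text \<open>On this event the observable \<open>f\<close> equals 1, while it starts below
  \<open>1 / card L\<close>. The exponent \<open>c\<close> may exceed
  \<open>\<kappa> * \<alpha>\<close>, which can lie below the 1 demanded by Bernoulli's
  inequality.\<close>

lemma prob_good_no_isolated_le:
  assumes "c \<ge> 1" "c \<ge> \<kappa> * \<alpha>"
  shows "measure_pmf.prob (process t) {E. good E \<and> isolated L E = {}}
    \<le> ((t + \<alpha> * card L) / (\<alpha> * card L)) powr c / card L"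
proof -
  define f where "f E = 1 / (card (isolated L E) + 1)" for E :: "'v set set"
  have a: "\<alpha> * card L > 0" using pos card_pos by simp
  have drift: "measure_pmf.expectation (step E) f \<le> (1 + c / (card E + \<alpha> * card L)) * f E"
    if "bipartite_edges L R E" "good E" for E
  proof -
    have "measure_pmf.expectation (step E) f \<le> (1 + \<kappa> * \<alpha> / (card E + \<alpha> * card L)) * f E"
      unfolding f_def using that by (rule expectation_isolated_le)
    also have "\<dots> \<le> (1 + c / (card E + \<alpha> * card L)) * f E"
      using assms a by (intro mult_right_mono add_left_mono divide_right_mono) (auto simp: f_def)
    finally show ?thesis .
  qed
  have "measure_pmf.prob (process t) {E. good E \<and> isolated L E = {}}
      = measure_pmf.expectation (process t) (indicator {E. good E \<and> isolated L E = {}})"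
    by simp
  also have "\<dots> \<le> measure_pmf.expectation (process t) (\<lambda>E. of_bool (good E) * f E)"
    by (rule expectation_mono_finite[OF finite_set_process]) (auto simp: f_def indicator_def)
  also have "\<dots> \<le> ((t + \<alpha> * card L) / (\<alpha> * card L)) powr c * f {}"
    by (rule expectation_good_le[OF _ a assms(1) drift]) (auto simp: f_def)
  also have "f {} \<le> 1 / card L"
    using card_pos by (auto simp: f_def isolated_def vertex_degree_def intro!: divide_left_mono mult_pos_pos)
  finally show ?thesis
    by (simp add: mult_left_mono)
qed

text \<open>A path from an isolated left vertex to a right vertex would have to start with an edge
  at it.\<close>

lemma connected_imp_no_isolated:
  assumes "bipartite_edges L R E" "graph_connected (L \<union> R) E"
  shows "isolated L E = {}"
proof (rule ccontr)
  assume "isolated L E \<noteq> {}"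
  then obtain u where u: "u \<in> L" "vertex_degree E u = 0" by (auto simp: isolated_def)
  obtain v where v: "v \<in> R" using nonempty by auto
  have "(u, v) \<in> {(a, b). {a, b} \<in> E}\<^sup>*"
    using assms(2) u v by (auto simp: graph_connected_def)
  then obtain w where "{u, w} \<in> E"
    using u v disj by (auto elim: converse_rtranclE)
  \<comment> \<open>Degrees are cardinalities, so finiteness of \<open>E\<close> enters
    here.\<close>
  moreover have "{e \<in> E. u \<in> e} = {}"
    using u finite_bipartite_edges[OF fin assms(1)] by (simp add: vertex_degree_def)
  ultimately show False by auto
qed

lemma prob_connected_le:
  fixes k :: nat
  defines "a \<equiv> min (\<alpha> * card L) (\<beta> * card R)"
  assumes "k \<ge> 1" "M > 0" "c \<ge> 1" "c \<ge> \<kappa> * \<alpha>"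
  shows "measure_pmf.prob (process t) {E. graph_connected (L \<union> R) E} \<le>
    t * (((t + a) / a) powr (\<kappa> * k) * (card L * pochhammer \<alpha> k + card R * pochhammer \<beta> k) / M ^ k)
    + ((t + \<alpha> * card L) / (\<alpha> * card L)) powr c / card L"
proof -
  have "measure_pmf.prob (process t) {E. graph_connected (L \<union> R) E}
      \<le> measure_pmf.prob (process t) ({E. \<not> good E} \<union> {E. good E \<and> isolated L E = {}})"
    using connected_imp_no_isolated[OF bipartite_edges_process]
    by (intro measure_pmf.finite_measure_mono_AE) (auto simp: AE_measure_pmf_iff)
  also have "\<dots> \<le> measure_pmf.prob (process t) {E. \<not> good E}
      + measure_pmf.prob (process t) {E. good E \<and> isolated L E = {}}"
    by (rule measure_Un_le) auto
  finally show ?thesis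
    using prob_not_good_le_moment[of k t] prob_good_no_isolated_le[of c t] assms
    by (simp add: a_def)
qed

end

section \<open>Asymptotics in the number of vertices\<close>

lemma tendsto_const_powr_neg:
  fixes C e :: real
  assumes "e < 0"
  shows "((\<lambda>x. C * x powr e) \<longlongrightarrow> 0) at_top"
  using tendsto_mult_right_zero[OF tendsto_neg_powr[OF assms filterlim_ident], of C] by simp

text \<open>Supplies the assumption \<open>small\<close> for \<open>M = x powr m\<close>: the
  product has order \<open>x powr (2 * m)\<close>, sublinear as \<open>m < 1 / 2\<close>.\<close>

lemma eventually_mult_le_linear:
  fixes m p q C :: real
  assumes "0 < m" "m < 1 / 2" "C > 0"
  shows "\<forall>\<^sub>F x in at_top. (x powr m + p) * (x powr m + q) \<le> C * x"
proof -
  have "((\<lambda>x. (x powr m + p) * (x powr m + q) / x) \<longlongrightarrow> 0) at_top"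
  proof (rule Lim_transform_eventually)
    show "((\<lambda>x::real. 1 * x powr (2 * m - 1) + (p + q) * x powr (m - 1) + (p * q) * x powr (-1)) \<longlongrightarrow> 0) at_top"
      using assms by (intro tendsto_add_zero tendsto_const_powr_neg) auto
    show "\<forall>\<^sub>F x in at_top. 1 * x powr (2 * m - 1) + (p + q) * x powr (m - 1) + (p * q) * x powr (-1)
        = (x powr m + p) * (x powr m + q) / x"
      using eventually_gt_at_top[of 0]
    proof eventually_elim
      case (elim x)
      have "x powr (2 * m - 1) = x powr m * x powr m / x"
        using elim by (simp add: powr_diff flip: powr_add)
      with elim show ?case
        by (simp add: powr_diff powr_minus field_simps)
    qed
  qed
  then have "\<forall>\<^sub>F x in at_top. (x powr m + p) * (x powr m + q) / x < C"
    using assms(3) by (rule order_tendstoD)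
  with eventually_gt_at_top[of 0] show ?thesis
    by eventually_elim (simp add: field_simps)
qed

lemma eventually_card_comparable:
  fixes l r :: "nat \<Rightarrow> nat"
  assumes "filterlim l at_top sequentially" "\<gamma> > 0" "(\<lambda>n. real (r n) / real (l n)) \<longlonglongrightarrow> \<gamma>"
  obtains c where "c > 0" "\<forall>\<^sub>F n in sequentially. c * real (l n + r n) \<le> l n \<and> c * real (l n + r n) \<le> r n"
proof
  \<comment> \<open>Eventually the ratio lies between \<open>\<gamma> / 2\<close> and
    \<open>2 * \<gamma>\<close>; then \<open>l + r \<le> (1 + 2 * \<gamma>) * l\<close> and
    \<open>\<gamma> * (l + r) \<le> (2 + \<gamma>) * r\<close>.\<close>
  define c where "c = min (1 / (1 + 2 * \<gamma>)) (\<gamma> / (2 + \<gamma>))"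
  show "c > 0" using assms(2) by (simp add: c_def add_pos_pos)
  have "\<forall>\<^sub>F n in sequentially. l n > 0"
    using eventually_gt_at_top assms(1) by (rule eventually_compose_filterlim)
  moreover have "\<forall>\<^sub>F n in sequentially. real (r n) / real (l n) < 2 * \<gamma>"
    "\<forall>\<^sub>F n in sequentially. real (r n) / real (l n) > \<gamma> / 2"
    using assms(2) order_tendstoD(1)[OF assms(3), of "\<gamma> / 2"]
      order_tendstoD(2)[OF assms(3), of "2 * \<gamma>"] by simp_all
  ultimately show "\<forall>\<^sub>F n in sequentially. c * real (l n + r n) \<le> l n \<and> c * real (l n + r n) \<le> r n"
  proof eventually_elim
    case (elim n)
    then have r: "real (r n) \<le> 2 * \<gamma> * l n" "\<gamma> * l n \<le> 2 * r n"
      by (simp_all add: field_simps)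
    have "c * real (l n + r n) \<le> 1 / (1 + 2 * \<gamma>) * real (l n + r n)"
      by (intro mult_right_mono) (auto simp: c_def)
    also have "\<dots> \<le> l n"
      using r assms(2) by (simp add: field_simps add_pos_pos)
    finally have 1: "c * real (l n + r n) \<le> l n" .
    have "c * real (l n + r n) \<le> \<gamma> / (2 + \<gamma>) * real (l n + r n)"
      by (intro mult_right_mono) (auto simp: c_def)
    also have "\<dots> \<le> r n"
      using r assms(2) by (simp add: field_simps add_pos_pos)
    finally show ?case using 1 by simp
  qed
qed

theorem theorem1p5:
  fixes \<alpha> \<beta> \<gamma> \<delta> :: real and L R :: "nat \<Rightarrow> 'v set"
  assumes "\<alpha> > 0" and "\<beta> > 0"
    and "\<And>n. finite (L n)" and "\<And>n. finite (R n)" and "\<And>n. L n \<inter> R n = {}"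
    and "filterlim (\<lambda>n. card (L n)) at_top sequentially"
    and "filterlim (\<lambda>n. card (R n)) at_top sequentially"
    and "\<gamma> > 0" and "(\<lambda>n. real (card (R n)) / real (card (L n))) \<longlonglongrightarrow> \<gamma>"
    and "\<delta> \<in> {0<..<disconnection_exponent \<alpha> \<beta>}"
  shows "(\<lambda>n. measure_pmf.prob
             (bipartite_process \<alpha> \<beta> (L n) (R n)
               (nat \<lfloor>real (card (L n) + card (R n)) powr (1 + \<delta>)\<rfloor>))
             {E. \<not> graph_connected (L n \<union> R n) E}) \<longlonglongrightarrow> 1"
proof -
  define N where "N n = real (card (L n) + card (R n))" for n
  define t where "t n = nat \<lfloor>N n powr (1 + \<delta>)\<rfloor>" for n
  \<comment> \<open>Above 1 to leave room for the adjacent pairs, at most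
    \<open>1 + \<alpha>\<close> so that \<open>\<kappa> * \<delta> < 1 / 2\<close>, and at most 2 so
    that \<open>\<kappa> * \<alpha> \<le> c\<close> below.\<close>
  define \<kappa> where "\<kappa> = 1 + min 1 (min \<alpha> \<beta>)"
  have \<delta>: "\<delta> > 0" "\<delta> * (2 * (1 + \<alpha>)) < 1"
    using assms(1,10) by (auto simp: disconnection_exponent_def field_simps)
  have \<kappa>: "\<kappa> > 1" "\<kappa> \<le> 2" "\<kappa> \<le> 1 + \<alpha>"
    using assms(1,2) by (auto simp: \<kappa>_def)
  have "\<kappa> * \<delta> \<le> (1 + \<alpha>) * \<delta>"
    using \<kappa> \<delta> by (intro mult_right_mono) auto
  then have "\<kappa> * \<delta> < 1 / 2"
    using \<delta>(2) by (simp add: algebra_simps)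
  then obtain m where m: "\<kappa> * \<delta> < m" "m < 1 / 2"
    using dense by blast
  have "m > 0"
    using m(1) mult_pos_pos[of \<kappa> \<delta>] \<kappa> \<delta> by linarith
  \<comment> \<open>This size of \<open>k\<close> makes
    \<open>2 + \<delta> - k * (m - \<kappa> * \<delta>)\<close> negative, the exponent of the first
    term of \<open>bound\<close>.\<close>
  obtain k :: nat where k: "(2 + \<delta>) / (m - \<kappa> * \<delta>) < k"
    using reals_Archimedean2 by blast
  then have k1: "k \<ge> 1"
    using m \<delta> by (cases k) (auto simp: field_simps)
  have k2: "1 + \<delta> + (\<delta> * (\<kappa> * k) + (1 - m * k)) < 0"
    using k m by (simp add: field_simps)
  \<comment> \<open>Exponent for the isolated vertices; the upper bound on \<delta> says exactly
    that \<open>\<delta> * c < 1\<close>.\<close>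
  define c where "c = 2 * (1 + \<alpha>)"
  have "\<kappa> * \<alpha> \<le> 2 * \<alpha>" using \<kappa> assms(1) by (intro mult_right_mono) auto
  then have "c \<ge> \<kappa> * \<alpha>" unfolding c_def using assms(1) by (simp only: distrib_left)
  then have c: "c \<ge> 1" "c \<ge> \<kappa> * \<alpha>" "\<delta> * c < 1"
    using assms(1) \<delta>(2) by (simp_all add: c_def)
  obtain c0 where c0: "c0 > 0"
    "\<forall>\<^sub>F n in sequentially. c0 * N n \<le> card (L n) \<and> c0 * N n \<le> card (R n)"
    unfolding N_def using eventually_card_comparable[OF assms(6,8,9)] by blast
  \<comment> \<open>Chosen so that \<open>c1 * N n\<close> is eventually below both
    \<open>\<alpha> * card (L n)\<close> and \<open>\<beta> * card (R n)\<close>.\<close>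
  define c1 where "c1 = c0 * min \<alpha> \<beta>"
  have c1: "c1 > 0" using c0 assms(1,2) by (simp add: c1_def)
  \<comment> \<open>With \<open>x powr \<delta> \<ge> 1\<close>, a growth ratio of at most
    \<open>1 + x powr \<delta> / c1\<close> is at most \<open>C * x powr \<delta>\<close>.\<close>
  define C where "C = 1 + 1 / c1"
  have C: "C > 0" using c1 by (simp add: C_def add_pos_pos)
  define P where "P = pochhammer \<alpha> k + pochhammer \<beta> k"
  \<comment> \<open>In the first exponent, \<open>1 + \<delta>\<close> comes from the number of
    steps, \<open>\<delta> * (\<kappa> * k)\<close> from the growth of the moments, 1 from their
    initial value and \<open>- m * k\<close> from \<open>M ^ k\<close>. The second term is the bound
    for isolated vertices.\<close>
  define bound where "bound x =
    C powr (\<kappa> * k) * P * x powr (1 + \<delta> + (\<delta> * (\<kappa> * k) + (1 - m * k)))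
    + C powr c / c0 * x powr (\<delta> * c - 1)" for x :: real
  have "filterlim (\<lambda>n. real (card (L n))) at_top sequentially"
    using filterlim_compose[OF filterlim_real_sequentially assms(6)] .
  then have Nlim: "filterlim N at_top sequentially"
    by (rule filterlim_at_top_mono) (auto simp: N_def)
  have "(bound \<longlongrightarrow> 0) at_top"
    unfolding bound_def using k2 c(3) by (intro tendsto_add_zero tendsto_const_powr_neg) auto
  then have bound_lim: "(\<lambda>n. bound (N n)) \<longlonglongrightarrow> 0"
    using Nlim by (rule filterlim_compose)
  \<comment> \<open>The factor \<open>2 * c1\<close> fits because
    \<open>\<alpha> * card (L n) + \<beta> * card (R n)\<close> is eventually at least
    \<open>2 * c1 * N n\<close>.\<close>
  have "\<forall>\<^sub>F x in at_top. (x powr m + \<alpha>) * (x powr m + \<beta>) \<le> (1 - 1 / \<kappa>) * (2 * c1) * x"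
    using \<open>m > 0\<close> m(2) \<kappa> c1 by (intro eventually_mult_le_linear mult_pos_pos) auto
  then have ev_small: "\<forall>\<^sub>F n in sequentially.
      (N n powr m + \<alpha>) * (N n powr m + \<beta>) \<le> (1 - 1 / \<kappa>) * (2 * c1) * N n"
    using Nlim by (rule eventually_compose_filterlim)
  have ev_N: "\<forall>\<^sub>F n in sequentially. N n \<ge> 1"
    using Nlim by (simp add: filterlim_at_top)
  have "\<forall>\<^sub>F n in sequentially. measure_pmf.prob (bipartite_process \<alpha> \<beta> (L n) (R n) (t n))
      {E. graph_connected (L n \<union> R n) E} \<le> bound (N n)"
    using c0(2) ev_small ev_N
  proof eventually_elim
    case (elim n)
    define x where "x = N n"
    define M where "M = x powr m"
    define a where "a = min (\<alpha> * card (L n)) (\<beta> * card (R n))"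
    have x: "x \<ge> 1" using elim by (simp add: x_def)
    have lr: "c0 * x \<le> card (L n)" "c0 * x \<le> card (R n)"
      using elim by (auto simp: x_def)
    have aL: "c1 * x \<le> \<alpha> * card (L n)"
    proof -
      have "c1 * x \<le> \<alpha> * (c0 * x)"
        using c0 x assms(1) by (simp add: c1_def mult_right_mono mult.commute mult.left_commute)
      then show ?thesis using mult_left_mono[OF lr(1), of \<alpha>] assms(1) by linarith
    qed
    have bR: "c1 * x \<le> \<beta> * card (R n)"
    proof -
      have "c1 * x \<le> \<beta> * (c0 * x)"
        using c0 x assms(1) by (simp add: c1_def mult_right_mono mult.commute mult.left_commute)
      then show ?thesis using mult_left_mono[OF lr(2), of \<beta>] assms(2) by linarith
    qed
    have c1x: "c1 * x > 0" "c0 * x > 0" using c1 c0 x by auto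
    have ne: "L n \<noteq> {}" "R n \<noteq> {}" using lr c1x by auto
    have "(M + \<alpha>) * (M + \<beta>) \<le> (1 - 1 / \<kappa>) * (2 * c1) * x"
      using elim by (simp add: M_def x_def)
    also have "\<dots> \<le> (1 - 1 / \<kappa>) * (\<alpha> * card (L n) + \<beta> * card (R n))"
      unfolding mult.assoc using aL bR \<kappa> by (intro mult_left_mono) auto
    finally interpret bounded_degree_regime \<alpha> \<beta> \<kappa> M "L n" "R n"
      using assms(1-5) ne \<kappa> by unfold_locales (auto simp: M_def)
    have Mpos: "M > 0" using x by (simp add: M_def)
    have "real (t n) \<le> x powr (1 + \<delta>)"
      by (simp add: t_def x_def)
    then have t: "real (t n) \<le> x powr (1 + \<delta>)" "real (t n) \<le> x * x powr \<delta>"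
      using x by (auto simp: powr_add)
    have ratio: "(t n + b) / b \<le> C * x powr \<delta>" if "c1 * x \<le> b" for b :: real
    proof -
      have b: "b > 0" using that c1x by linarith
      have "(t n + b) / b = 1 + t n / b" using b by (simp add: field_simps)
      also have "t n / b \<le> (x * x powr \<delta>) / (c1 * x)"
        using t(2) that c1x x by (intro frac_le) auto
      also have "\<dots> = x powr \<delta> / c1" using x by simp
      also have "1 + x powr \<delta> / c1 \<le> x powr \<delta> + x powr \<delta> / c1"
        using x \<delta> by (simp add: ge_one_powr_ge_zero)
      finally show ?thesis by (simp add: C_def algebra_simps)
    qed
    have ratio': "((t n + b) / b) powr e \<le> C powr e * x powr (\<delta> * e)" if "c1 * x \<le> b" "e \<ge> 0" for b e :: real
    proof -
      have "b > 0" using that c1x by linarith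
      then have "((t n + b) / b) powr e \<le> (C * x powr \<delta>) powr e"
        using ratio[OF that(1)] that(2) by (intro powr_mono2) auto
      also have "\<dots> = C powr e * x powr (\<delta> * e)"
        using C by (simp add: powr_mult powr_powr)
      finally show ?thesis .
    qed
    have poch: "pochhammer \<alpha> k \<ge> 0" "pochhammer \<beta> k \<ge> 0"
      using assms(1,2) by (auto intro: pochhammer_nonneg)
    have "real (card (L n)) * pochhammer \<alpha> k + card (R n) * pochhammer \<beta> k \<le> x * pochhammer \<alpha> k + x * pochhammer \<beta> k"
      using poch by (intro add_mono mult_right_mono) (auto simp: x_def N_def)
    also have "\<dots> = P * x" by (simp add: P_def algebra_simps)
    finally have mom: "real (card (L n)) * pochhammer \<alpha> k + card (R n) * pochhammer \<beta> k \<le> P * x" .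
    have "measure_pmf.prob (process (t n)) {E. graph_connected (L n \<union> R n) E} \<le>
      t n * (((t n + a) / a) powr (\<kappa> * k) * (card (L n) * pochhammer \<alpha> k + card (R n) * pochhammer \<beta> k) / M ^ k)
      + ((t n + \<alpha> * card (L n)) / (\<alpha> * card (L n))) powr c / card (L n)"
      unfolding a_def using k1 Mpos c by (intro prob_connected_le)
    also have "\<dots> \<le> x powr (1 + \<delta>) * ((C powr (\<kappa> * k) * x powr (\<delta> * (\<kappa> * k))) * (P * x) / M ^ k)
      + (C powr c * x powr (\<delta> * c)) / (c0 * x)"
      using t(1) mom Mpos poch c1x lr c \<kappa> aL bR ratio'[of a "\<kappa> * k"] ratio'[of "\<alpha> * card (L n)" c]
      by (intro add_mono mult_mono divide_right_mono frac_le)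
         (auto simp: a_def intro!: mult_nonneg_nonneg add_nonneg_nonneg divide_nonneg_nonneg)
    also have "M ^ k = x powr (m * k)"
      using x by (simp add: M_def powr_powr flip: powr_realpow)
    also have "x powr (1 + \<delta>) * ((C powr (\<kappa> * k) * x powr (\<delta> * (\<kappa> * k))) * (P * x) / x powr (m * k))
      + (C powr c * x powr (\<delta> * c)) / (c0 * x) = bound x"
      using x unfolding bound_def by (simp add: powr_add powr_diff power2_eq_square)
    finally show ?case by (simp add: x_def)
  qed
  then have "(\<lambda>n. measure_pmf.prob (bipartite_process \<alpha> \<beta> (L n) (R n) (t n))
      {E. graph_connected (L n \<union> R n) E}) \<longlonglongrightarrow> 0"
    by (intro tendsto_sandwich[OF _ _ tendsto_const bound_lim]) auto
  then have "(\<lambda>n. 1 - measure_pmf.prob (bipartite_process \<alpha> \<beta> (L n) (R n) (t n))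
      {E. graph_connected (L n \<union> R n) E}) \<longlonglongrightarrow> 1 - 0"
    by (intro tendsto_diff tendsto_const)
  moreover have "1 - measure_pmf.prob p {E. graph_connected V E}
      = measure_pmf.prob p {E. \<not> graph_connected V E}" for p and V :: "'v set"
    using measure_pmf.prob_compl[of "{E. graph_connected V E}" p]
    by (simp add: Compl_eq_Diff_UNIV[symmetric] Collect_neg_eq)
  ultimately show ?thesis by (simp add: t_def N_def)
qed

end
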